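(* Let $(X,Y),(X_1,Y_1),\dots,(X_n,Y_n)$ be i.i.d. random pairs in $\mathbb R^d\times\{-1,1\}$ with $\|X\|\le R$ almost surely for some constant $R>0$, and let $\lambda\ge2R^2/(n+1)$. Then the Ridge-regularized logistic Sample Minmax Predictor $\widetilde f_{\lambda,n}$ satisfies $$\mathbb E\big[\mathcal R(\widetilde f_{\lambda,n})\big]-\inf_{\theta\in\mathbb R^d}\Big\{\mathcal R(f_\theta)+\frac\lambda2\|\theta\|^2\Big\}\le e\cdot\frac{\mathsf{df}_{4\lambda}(\Sigma)}{n},$$ where $\Sigma=\mathbb E[XX^\top]$ and $\mathsf{df}_{\lambda}(\Sigma)=\operatorname{tr}[(\Sigma+\lambda I_d)^{-1}\Sigma]$.
   Context: Let $\sigma(u)=e^u/(1+e^u)$. The logistic model is $f_\theta(y\mid x)=\sigma(y\langle\theta,x\rangle)$ for $\theta,x\in\mathbb R^d$, $y\in\{-1,1\}$. For a conditional probability mass function $g(y\mid x)$ on $\{-1,1\}$, the risk is $\mathcal R(g)=\mathbb E[-\log g(Y\mid X)]$; $\mathbb E[\mathcal R(\widetilde f_{\lambda,n})]$ is the expectation over the sample. For $(x,y)\in\mathbb R^d\times\{-1,1\}$ let $$\widehat\theta_{\lambda,n}^{(x,y)}=\operatorname*{arg\,min}_{\theta\in\mathbb R^d}\Big\{\frac1{n+1}\Big(\sum_{i=1}^n\log(1+e^{-Y_i\langle\theta,X_i\rangle})+\log(1+e^{-y\langle\theta,x\rangle})\Big)+\frac\lambda2\|\theta\|^2\Big\}.$$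 The Ridge-regularized logistic Sample Minmax Predictor is $$\widetilde f_{\lambda,n}(y\mid x)=\frac{\sigma(y\langle\widehat\theta_{\lambda,n}^{(x,y)},x\rangle)\,e^{-\lambda\|\widehat\theta_{\lambda,n}^{(x,y)}\|^2/2}}{\sigma(\langle\widehat\theta_{\lambda,n}^{(x,1)},x\rangle)\,e^{-\lambda\|\widehat\theta_{\lambda,n}^{(x,1)}\|^2/2}+\sigma(-\langle\widehat\theta_{\lambda,n}^{(x,-1)},x\rangle)\,e^{-\lambda\|\widehat\theta_{\lambda,n}^{(x,-1)}\|^2/2}}.$$ *)

theory Defs
  imports "HOL-Probability.Probability"
begin

definition sigmoid :: "real \<Rightarrow> real" where
  "sigmoid u = exp u / (1 + exp u)"

text \<open>A conditional mass function \<open>g(y | x)\<close> on \<open>{-1, 1}\<close> is represented as \<open>g y x\<close>;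
  only its values at \<open>y = 1\<close> and \<open>y = -1\<close> matter.\<close>

definition logistic_model :: "real ^ 'd \<Rightarrow> real \<Rightarrow> real ^ 'd \<Rightarrow> real" where
  "logistic_model \<theta> y x = sigmoid (y * (\<theta> \<bullet> x))"

definition risk ::
  "'a measure \<Rightarrow> ('a \<Rightarrow> real ^ 'd) \<Rightarrow> ('a \<Rightarrow> real) \<Rightarrow> (real \<Rightarrow> real ^ 'd \<Rightarrow> real) \<Rightarrow> real" where
  "risk M X Y g = (\<integral>\<omega>. - ln (g (Y \<omega>) (X \<omega>)) \<partial>M)"

text \<open>The sample consists of \<open>(xs i, ys i)\<close> for \<open>i = 1, \<dots>, n\<close>; other indices are ignored.\<close>

definition ridge_objective ::
  "real \<Rightarrow> nat \<Rightarrow> (nat \<Rightarrow> real ^ 'd) \<Rightarrow> (nat \<Rightarrow> real) \<Rightarrow> real ^ 'd \<Rightarrow> real \<Rightarrow> real ^ 'd \<Rightarrow> real" where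
  "ridge_objective lam n xs ys x y \<theta> =
     1 / (real n + 1) *
       ((\<Sum>i=1..n. ln (1 + exp (- ys i * (\<theta> \<bullet> xs i)))) + ln (1 + exp (- y * (\<theta> \<bullet> x))))
     + lam / 2 * (norm \<theta>)\<^sup>2"

text \<open>For \<open>lam > 0\<close> the objective is strongly convex, so the minimizer chosen by
  \<open>arg_min\<close> exists and is unique.\<close>

definition ridge_estimator ::
  "real \<Rightarrow> nat \<Rightarrow> (nat \<Rightarrow> real ^ 'd) \<Rightarrow> (nat \<Rightarrow> real) \<Rightarrow> real ^ 'd \<Rightarrow> real \<Rightarrow> real ^ 'd" where
  "ridge_estimator lam n xs ys x y = arg_min (ridge_objective lam n xs ys x y) (\<lambda>_. True)"

definition smp_weight ::
  "real \<Rightarrow> nat \<Rightarrow> (nat \<Rightarrow> real ^ 'd) \<Rightarrow> (nat \<Rightarrow> real) \<Rightarrow> real \<Rightarrow> real ^ 'd \<Rightarrow> real" where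
  "smp_weight lam n xs ys y x =
     (let \<theta> = ridge_estimator lam n xs ys x y
      in sigmoid (y * (\<theta> \<bullet> x)) * exp (- lam * (norm \<theta>)\<^sup>2 / 2))"

definition ridge_smp ::
  "real \<Rightarrow> nat \<Rightarrow> (nat \<Rightarrow> real ^ 'd) \<Rightarrow> (nat \<Rightarrow> real) \<Rightarrow> real \<Rightarrow> real ^ 'd \<Rightarrow> real" where
  "ridge_smp lam n xs ys y x =
     smp_weight lam n xs ys y x / (smp_weight lam n xs ys 1 x + smp_weight lam n xs ys (- 1) x)"

definition second_moment :: "'a measure \<Rightarrow> ('a \<Rightarrow> real ^ 'd) \<Rightarrow> real ^ 'd ^ 'd" where
  "second_moment M X = (\<integral>\<omega>. (\<chi> i j. X \<omega> $ i * X \<omega> $ j) \<partial>M)"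

definition deg_freedom :: "real \<Rightarrow> real ^ 'd ^ 'd \<Rightarrow> real" where
  "deg_freedom lam S = trace (matrix_inv (S + lam *\<^sub>R mat 1) ** S)"

end

theory Submission
  imports Defs
begin

text \<open>
  Treat the test pair as index \<open>0\<close> of a sample of size \<open>n + 1\<close>. By exchangeability the expected risk
  of the predictor is the average, over all indices \<open>i\<close>, of the expected loss when pair \<open>i\<close> plays the
  test point, so that it suffices to bound the sum of these losses for every fixed sample. With
  \<open>\<theta>\<close> the ridge estimator of the whole sample, the \<open>i\<close>-th loss is the regularised loss of \<open>\<theta>\<close> at pair
  \<open>i\<close> plus the logarithm of the normalising constant. The former terms sum to the minimum of the ridge
  objective. The latter is at most \<open>\<sigma>\<langle>\<theta>\<^sup>+, x\<^sub>i\<rangle> - \<sigma>\<langle>\<theta>\<^sup>-, x\<^sub>i\<rangle>\<close>, where \<open>\<theta>\<^sup>+\<close> and \<open>\<theta>\<^sup>-\<close> are the estimators with label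
  \<open>1\<close> and \<open>-1\<close> at \<open>i\<close>. The two normal equations say \<open>H (\<theta>\<^sup>+ - \<theta>\<^sup>-) = x\<^sub>i\<close> for a Hessian \<open>H\<close> built from slopes of
  \<open>\<sigma>\<close>; as \<open>\<lambda>\<close> is large, \<open>|\<langle>\<theta>\<^sup>+ - \<theta>\<^sup>-, x\<^sub>j\<rangle>| \<le> 1/2\<close> for all \<open>j\<close>, and \<open>ln \<circ> \<sigma>'\<close> is \<open>1\<close>-Lipschitz, so the slopes
  agree with the \<open>\<sigma>'\<langle>\<theta>, x\<^sub>j\<rangle>\<close> up to a factor \<open>exp (1/2)\<close>. This bounds the sum over \<open>i\<close> by \<open>e\<close> times the degrees
  of freedom of the Hessian at \<open>\<theta>\<close>. Degrees of freedom are an infimum of linear functions of the matrix;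
  evaluating at the matrix that is optimal for \<open>\<Sigma> / 4\<close>, and using \<open>\<sigma>' \<le> 1/4\<close>, makes the bound a sum of
  functions of the individual pairs, whose expectation is immediate.
\<close>

subsection \<open>The sigmoid function\<close>

lemma sigmoid_pos: "0 < sigmoid u" and sigmoid_less_1: "sigmoid u < 1"
  by (simp_all add: sigmoid_def field_simps add_pos_pos)

lemma sigmoid_minus: "sigmoid (- u) = 1 - sigmoid u"
proof -
  have "1 + exp u \<noteq> 0" using exp_gt_zero[of u] by linarith
  then show ?thesis by (simp add: sigmoid_def exp_minus field_simps)
qed

lemma ln_one_plus_exp: "ln (1 + exp (- u)) = - ln (sigmoid u)"
proof -
  have "sigmoid u = inverse (1 + exp (- u))"
    using exp_gt_zero[of u] by (simp add: sigmoid_def exp_minus field_simps)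
  then show ?thesis by (simp add: ln_inverse add_pos_pos)
qed

lemma has_real_derivative_sigmoid [derivative_intros]:
  "(f has_real_derivative f') (at x within A) \<Longrightarrow>
   ((\<lambda>x. sigmoid (f x)) has_real_derivative (sigmoid (f x) * (1 - sigmoid (f x)) * f')) (at x within A)"
proof -
  have nz: "1 + exp u \<noteq> 0" for u :: real using exp_gt_zero[of u] by linarith
  have "(sigmoid has_real_derivative sigmoid u * (1 - sigmoid u)) (at u)" for u
    unfolding sigmoid_def[abs_def]
    by (rule derivative_eq_intros refl nz)+ (use nz[of u] in \<open>simp add: divide_simps; simp add: algebra_simps\<close>)
  then show "(f has_real_derivative f') (at x within A) \<Longrightarrow> ?thesis"
    by (rule DERIV_chain2)
qed

lemma continuous_on_sigmoid [continuous_intros]: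
  "continuous_on A f \<Longrightarrow> continuous_on A (\<lambda>x. sigmoid (f x))"
proof -
  have "1 + exp u \<noteq> 0" for u :: real using exp_gt_zero[of u] by linarith
  then show "continuous_on A f \<Longrightarrow> ?thesis"
    unfolding sigmoid_def by (intro continuous_intros) auto
qed

lemma sigmoid_mono: "u \<le> v \<Longrightarrow> sigmoid u \<le> sigmoid v"
  using exp_gt_zero[of u] exp_gt_zero[of v]
  by (simp add: sigmoid_def divide_simps add_pos_pos) (simp add: algebra_simps)

definition sigmoid' :: "real \<Rightarrow> real" where
  "sigmoid' u = sigmoid u * (1 - sigmoid u)"

lemma sigmoid'_pos: "0 < sigmoid' u"
  using sigmoid_pos[of u] sigmoid_less_1[of u] by (simp add: sigmoid'_def)

lemma sigmoid'_le: "sigmoid' u \<le> 1 / 4"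
  using zero_le_power2[of "sigmoid u - 1 / 2"]
  by (simp add: sigmoid'_def power2_eq_square algebra_simps)

text \<open>The reciprocal of \<open>sigmoid' w\<close> is \<open>2 + exp w + exp (- w)\<close>, and
  each of the three summands grows by a factor of at most \<open>exp \<bar>u - v\<bar>\<close>
  between \<open>u\<close> and \<open>v\<close>.\<close>

lemma sigmoid'_le_exp: "sigmoid' u \<le> exp \<bar>u - v\<bar> * sigmoid' v"
proof -
  have eq: "sigmoid' w = 1 / (2 + exp w + exp (- w))" for w
  proof -
    have nz: "1 + exp w \<noteq> 0" using exp_gt_zero[of w] by linarith
    have "sigmoid' w = exp w / (1 + exp w)\<^sup>2"
      using nz by (simp add: sigmoid'_def sigmoid_def field_simps power2_eq_square)
    also have "(1 + exp w)\<^sup>2 = exp w * (2 + exp w + exp (- w))"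
      by (simp add: power2_eq_square algebra_simps flip: exp_add)
    finally show ?thesis by simp
  qed
  have "2 \<le> 2 * exp \<bar>u - v\<bar>" by simp
  moreover have "exp v \<le> exp \<bar>u - v\<bar> * exp u" "exp (- v) \<le> exp \<bar>u - v\<bar> * exp (- u)"
    by (simp_all flip: exp_add)
  ultimately have "2 + exp v + exp (- v) \<le> exp \<bar>u - v\<bar> * (2 + exp u + exp (- u))"
    unfolding distrib_left by linarith
  moreover have "2 + exp w + exp (- w) > 0" for w :: real by (simp add: add_pos_pos)
  ultimately show ?thesis by (simp add: eq divide_simps)
qed

text \<open>By the mean value theorem \<open>a\<close> is \<open>sigmoid' c\<close> for some
  \<open>c\<close> within distance \<open>\<bar>u - v\<bar>\<close> of both ends. Both ends are
  allowed for \<open>w\<close> because either may belong to the true label; the product form covers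
  \<open>u = v\<close>.\<close>

lemma sigmoid_slope:
  obtains a where "sigmoid u - sigmoid v = a * (u - v)"
    "\<And>w. w = u \<or> w = v \<Longrightarrow> a \<le> exp \<bar>u - v\<bar> * sigmoid' w"
    "\<And>w. w = u \<or> w = v \<Longrightarrow> sigmoid' w \<le> exp \<bar>u - v\<bar> * a"
proof -
  have D: "(sigmoid has_real_derivative sigmoid' x) (at x)" for x
    using has_real_derivative_sigmoid[OF DERIV_ident, of x] by (simp add: sigmoid'_def)
  have "\<exists>c. sigmoid u - sigmoid v = sigmoid' c * (u - v) \<and> \<bar>c - u\<bar> \<le> \<bar>u - v\<bar> \<and> \<bar>c - v\<bar> \<le> \<bar>u - v\<bar>"
  proof (cases u v rule: linorder_cases)
    case less
    from MVT2[OF less D] obtain c where "u < c" "c < v" "sigmoid v - sigmoid u = (v - u) * sigmoid' c"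
      by auto
    then show ?thesis by (intro exI[of _ c]) (auto simp: algebra_simps)
  next
    case greater
    from MVT2[OF greater D] obtain c where "v < c" "c < u" "sigmoid u - sigmoid v = (u - v) * sigmoid' c"
      by auto
    then show ?thesis by (intro exI[of _ c]) (auto simp: algebra_simps)
  qed auto
  then obtain c where c: "sigmoid u - sigmoid v = sigmoid' c * (u - v)"
      "\<bar>c - u\<bar> \<le> \<bar>u - v\<bar>" "\<bar>c - v\<bar> \<le> \<bar>u - v\<bar>" by blast
  have le: "exp \<bar>c - w\<bar> * s \<le> exp \<bar>u - v\<bar> * s" if "w = u \<or> w = v" "s > 0" for w s
    using that c by (intro mult_right_mono) auto
  show ?thesis
  proof (rule that[OF c(1)])
    fix w assume w: "w = u \<or> w = v"
    show "sigmoid' c \<le> exp \<bar>u - v\<bar> * sigmoid' w"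
      using sigmoid'_le_exp[of c w] le[OF w sigmoid'_pos] by (rule order_trans)
    show "sigmoid' w \<le> exp \<bar>u - v\<bar> * sigmoid' c"
      using sigmoid'_le_exp[of w c] le[OF w sigmoid'_pos[of c]] by (simp add: abs_minus_commute)
  qed
qed

subsection \<open>Ridge regularisation in linear algebra\<close>

text \<open>Coercivity makes the kernel trivial, and an injective linear map of a finite-dimensional
  space into itself is onto. This solves Hessian equations without forming inverse matrices.\<close>

lemma coercive_linear_surj:
  fixes H :: "'a::euclidean_space \<Rightarrow> 'a"
  assumes "linear H" "m > 0" "\<And>v. m * (norm v)\<^sup>2 \<le> H v \<bullet> v"
  shows "\<exists>v. H v = w"
proof -
  have "v = 0" if "H v = 0" for v
    using assms(3)[of v] \<open>m > 0\<close> that by (simp add: mult_le_0_iff)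
  then have "inj H"
    using \<open>linear H\<close> by (simp add: linear_injective_0)
  then show ?thesis
    using linear_injective_imp_surjective[OF \<open>linear H\<close>] by (metis surjD)
qed

text \<open>With \<open>A = (\<Sum>i\<in>I. b i *\<^sub>R x i (x i)\<^sup>T)\<close>, the left-hand side is the trace of \<open>(A + m)\<^sup>-\<^sup>1 A\<close>, and the
  right-hand side is minimised at \<open>k = (A + m)\<^sup>-\<^sup>1 A\<close>, where equality holds.\<close>

lemma ridge_trace_le:
  fixes x v :: "'i \<Rightarrow> 'a::euclidean_space" and k :: "'a \<Rightarrow> 'a"
  assumes m: "m > 0" and b: "\<And>i. i \<in> I \<Longrightarrow> b i \<ge> 0"
    and v: "\<And>i. i \<in> I \<Longrightarrow> m *\<^sub>R v i + (\<Sum>j\<in>I. (b j * (x j \<bullet> v i)) *\<^sub>R x j) = x i"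
  shows "(\<Sum>i\<in>I. b i * (x i \<bullet> v i))
    \<le> (\<Sum>e\<in>Basis. (\<Sum>i\<in>I. b i * (x i \<bullet> (e - k e))\<^sup>2) / m + (norm (k e))\<^sup>2)"
proof -
  define S where "S u = (\<Sum>j\<in>I. (b j * (x j \<bullet> u)) *\<^sub>R x j)" for u
  \<comment> \<open>As \<open>v i\<close> stands for \<open>(A + m)^(-1)\<close> applied to
    \<open>x i\<close>, this is the optimal choice of \<open>k e\<close>.\<close>
  define q where "q e = (\<Sum>i\<in>I. (b i * (x i \<bullet> e)) *\<^sub>R v i)" for e
  have Sinner: "S u \<bullet> w = (\<Sum>j\<in>I. b j * (x j \<bullet> u) * (x j \<bullet> w))" for u w
    by (simp add: S_def inner_sum_left)
  have Sdiff: "S (u - w) = S u - S w" for u w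
    by (simp add: S_def inner_diff_right algebra_simps sum_subtractf)
  have q: "m *\<^sub>R q e + S (q e) = S e" for e
  proof -
    have "S (q e) = (\<Sum>i\<in>I. (b i * (x i \<bullet> e)) *\<^sub>R S (v i))"
      unfolding S_def q_def inner_sum_right scaleR_sum_right sum_distrib_left scaleR_sum_left
      by (subst sum.swap) (intro sum.cong refl; simp add: mult_ac)
    then have "m *\<^sub>R q e + S (q e) = (\<Sum>i\<in>I. (b i * (x i \<bullet> e)) *\<^sub>R (m *\<^sub>R v i + S (v i)))"
      by (simp add: q_def scaleR_sum_right sum.distrib algebra_simps)
    also have "\<dots> = (\<Sum>i\<in>I. (b i * (x i \<bullet> e)) *\<^sub>R x i)"
      by (intro sum.cong refl) (simp add: v S_def)
    finally show ?thesis by (simp add: S_def)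
  qed
  have min: "e \<bullet> q e \<le> (\<Sum>i\<in>I. b i * (x i \<bullet> (e - k e))\<^sup>2) / m + (norm (k e))\<^sup>2" for e
  proof -
    \<comment> \<open>Complete the square around \<open>q e\<close>: the terms linear in
      \<open>d\<close> cancel by the equation \<open>r\<close>, and the terms quadratic in
      \<open>d\<close> are nonnegative.\<close>
    define d where "d = k e - q e"
    have r: "S (e - q e) = m *\<^sub>R q e" using q[of e] by (simp add: Sdiff algebra_simps)
    have "(\<Sum>i\<in>I. b i * (x i \<bullet> (e - k e))\<^sup>2) = S (e - k e) \<bullet> (e - k e)"
      by (simp add: Sinner power2_eq_square mult_ac)
    also have "e - k e = (e - q e) - d" by (simp add: d_def)
    also have "S ((e - q e) - d) \<bullet> ((e - q e) - d)
      = S (e - q e) \<bullet> (e - q e) - 2 * (S (e - q e) \<bullet> d) + S d \<bullet> d"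
    proof -
      have "S d \<bullet> (e - q e) = S (e - q e) \<bullet> d" by (simp add: Sinner mult_ac)
      then show ?thesis unfolding Sdiff[of "e - q e" d] by (simp add: inner_diff_left inner_diff_right)
    qed
    also have "\<dots> = m * (q e \<bullet> (e - q e)) - 2 * m * (q e \<bullet> d) + S d \<bullet> d" by (simp add: r)
    finally have "(\<Sum>i\<in>I. b i * (x i \<bullet> (e - k e))\<^sup>2) + m * (norm (k e))\<^sup>2
       = m * (e \<bullet> q e) + S d \<bullet> d + m * (d \<bullet> d)"
      by (simp add: d_def power2_norm_eq_inner inner_diff_left inner_diff_right algebra_simps inner_commute)
    moreover have "S d \<bullet> d \<ge> 0" using b by (auto simp: Sinner mult.assoc intro!: sum_nonneg)
    moreover have "m * (d \<bullet> d) \<ge> 0" using m by simp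
    ultimately show ?thesis using m by (simp add: divide_simps algebra_simps)
  qed
  \<comment> \<open>Expanding the inner products in the basis turns the sum into the trace of
    \<open>q\<close>.\<close>
  have "(\<Sum>i\<in>I. b i * (x i \<bullet> v i)) = (\<Sum>i\<in>I. b i * (\<Sum>e\<in>Basis. (x i \<bullet> e) * (v i \<bullet> e)))"
    by (intro sum.cong refl arg_cong2[of _ _ _ _ "(*)"] euclidean_inner)
  also have "\<dots> = (\<Sum>e\<in>Basis. e \<bullet> q e)"
    unfolding q_def inner_sum_right sum_distrib_left by (subst sum.swap) (simp add: inner_commute mult_ac)
  also have "\<dots> \<le> (\<Sum>e\<in>Basis. (\<Sum>i\<in>I. b i * (x i \<bullet> (e - k e))\<^sup>2) / m + (norm (k e))\<^sup>2)"
    by (intro sum_mono min)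
  finally show ?thesis .
qed

lemma trace_eq_sum_Basis:
  fixes A :: "real ^ 'd ^ 'd"
  shows "trace A = (\<Sum>e\<in>Basis. e \<bullet> (A *v e))"
proof -
  have B: "(Basis :: (real ^ 'd) set) = (\<lambda>i. axis i 1) ` UNIV" by (auto simp: Basis_vec_def)
  have "inj (\<lambda>i :: 'd. axis i (1 :: real))" by (auto simp: inj_on_def axis_eq_axis)
  from sum.reindex[OF this, of "\<lambda>e. e \<bullet> (A *v e)"] show ?thesis
    unfolding B by (simp add: trace_def inner_axis' matrix_vector_mult_basis column_def)
qed

text \<open>Nonnegativity of the quadratic form makes \<open>S + c *\<^sub>R mat 1\<close>
  injective, so \<open>matrix_inv\<close> is a genuine inverse; the claim rearranges its defining
  equation. It has the form of the optimality condition behind the ridge trace bound.\<close>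

lemma ridge_projection_eq:
  fixes S :: "real ^ 'd ^ 'd"
  assumes psd: "\<And>u. 0 \<le> (S *v u) \<bullet> u" and "c > 0"
  shows "S *v (u - (matrix_inv (S + c *\<^sub>R mat 1) ** S) *v u)
    = c *\<^sub>R ((matrix_inv (S + c *\<^sub>R mat 1) ** S) *v u)"
proof -
  let ?T = "S + c *\<^sub>R mat 1"
  have T: "?T *v u = S *v u + c *\<^sub>R u" for u
    by (simp add: matrix_vector_mult_add_rdistrib scaleR_matrix_vector_assoc[symmetric])
  have "u = 0" if "?T *v u = 0" for u
  proof -
    have "(S *v u) \<bullet> u + c * (u \<bullet> u) = 0"
      using arg_cong[OF that, of "\<lambda>v. v \<bullet> u"] by (simp add: T inner_add_left)
    then have "c * (u \<bullet> u) = 0"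
      using psd[of u] \<open>c > 0\<close> by (smt (verit) inner_ge_zero mult_nonneg_nonneg)
    then show ?thesis using \<open>c > 0\<close> by simp
  qed
  then have "invertible ?T"
    unfolding invertible_left_inverse matrix_left_invertible_ker by blast
  then have "?T ** matrix_inv ?T = mat 1"
    unfolding invertible_def matrix_inv_def by (rule someI2_ex) simp
  then have "?T *v ((matrix_inv ?T ** S) *v u) = S *v u"
    by (simp add: matrix_vector_mul_assoc matrix_mul_assoc)
  from this[unfolded T] show ?thesis
    unfolding matrix_vector_mult_diff_distrib by (metis add_diff_cancel_left')
qed

subsection \<open>The ridge-regularised logistic estimator\<close>

definition logistic_loss :: "(real ^ 'd) \<times> real \<Rightarrow> real ^ 'd \<Rightarrow> real" where
  "logistic_loss p \<theta> = ln (1 + exp (- snd p * (\<theta> \<bullet> fst p)))"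

lemma logistic_loss_eq: "logistic_loss p \<theta> = - ln (sigmoid (snd p * (\<theta> \<bullet> fst p)))"
  using ln_one_plus_exp[of "snd p * (\<theta> \<bullet> fst p)"] by (simp add: logistic_loss_def)

lemma logistic_loss_nonneg: "0 \<le> logistic_loss p \<theta>"
  by (simp add: logistic_loss_def)

text \<open>A sample together with the test pair is a function \<open>z\<close>, of which only the values at
  \<open>0, \<dots>, n\<close> matter; the test pair sits at index \<open>0\<close>, but the estimator treats all indices alike.\<close>

definition ridge_obj :: "real \<Rightarrow> nat \<Rightarrow> (nat \<Rightarrow> (real ^ 'd) \<times> real) \<Rightarrow> real ^ 'd \<Rightarrow> real" where
  "ridge_obj lam n z \<theta> = (\<Sum>i\<le>n. logistic_loss (z i) \<theta>) / (real n + 1) + lam / 2 * (norm \<theta>)\<^sup>2"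

definition ridge_est :: "real \<Rightarrow> nat \<Rightarrow> (nat \<Rightarrow> (real ^ 'd) \<times> real) \<Rightarrow> real ^ 'd" where
  "ridge_est lam n z = arg_min (ridge_obj lam n z) (\<lambda>_. True)"

text \<open>The gradient of \<open>ridge_obj\<close>, multiplied by \<open>n + 1\<close> to clear
  the denominator.\<close>

definition ridge_grad :: "real \<Rightarrow> nat \<Rightarrow> (nat \<Rightarrow> (real ^ 'd) \<times> real) \<Rightarrow> real ^ 'd \<Rightarrow> real ^ 'd" where
  "ridge_grad lam n z \<theta> =
     ((real n + 1) * lam) *\<^sub>R \<theta>
     - (\<Sum>i\<le>n. (snd (z i) * sigmoid (- snd (z i) * (\<theta> \<bullet> fst (z i)))) *\<^sub>R fst (z i))"

lemma ridge_obj_mult_Suc: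
  "(real n + 1) * ridge_obj lam n z \<theta> = (\<Sum>i\<le>n. logistic_loss (z i) \<theta> + lam / 2 * (norm \<theta>)\<^sup>2)"
proof -
  have "real n + 1 \<noteq> 0" by linarith
  then show ?thesis by (simp add: ridge_obj_def sum.distrib distrib_left add.commute)
qed

lemma ridge_estimator_eq:
  "ridge_estimator lam n xs ys x y = ridge_est lam n ((\<lambda>i. (xs i, ys i))(0 := (x, y)))"
proof -
  have "ridge_objective lam n xs ys x y = ridge_obj lam n ((\<lambda>i. (xs i, ys i))(0 := (x, y)))"
    unfolding ridge_objective_def[abs_def] ridge_obj_def[abs_def]
    by (simp add: sum.atMost_shift sum.atLeast_Suc_atMost_Suc_shift logistic_loss_def
        atLeast0LessThan lessThan_Suc_atMost sum.atLeast1_atMost_eq field_simps)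
  then show ?thesis by (simp add: ridge_estimator_def ridge_est_def)
qed

lemma ridge_est_cong:
  assumes "\<And>i. i \<le> n \<Longrightarrow> z i = z' i"
  shows "ridge_est lam n z = ridge_est lam n z'"
proof -
  have "ridge_obj lam n z = ridge_obj lam n z'"
    using assms by (auto simp: ridge_obj_def fun_eq_iff intro!: sum.cong)
  then show ?thesis by (simp add: ridge_est_def)
qed

lemma ridge_est_permute:
  assumes "p permutes {..n}"
  shows "ridge_est lam n (z \<circ> p) = ridge_est lam n z"
proof -
  have "ridge_obj lam n (z \<circ> p) = ridge_obj lam n z"
    using sum.permute[OF assms, of "\<lambda>i. logistic_loss (z i) _"]
    by (simp add: ridge_obj_def fun_eq_iff o_def)
  then show ?thesis by (simp add: ridge_est_def)
qed

text \<open>Since \<open>arg_min\<close> is a choice operator, the content is existence of a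
  minimiser: the penalty confines the search to a compact ball.\<close>

lemma ridge_est_is_min:
  assumes "lam > 0"
  shows "ridge_obj lam n z (ridge_est lam n z) \<le> ridge_obj lam n z \<theta>"
proof -
  let ?F = "ridge_obj lam n z"
  \<comment> \<open>Outside this radius the penalty alone exceeds the objective at
    \<open>0\<close>.\<close>
  define B where "B = sqrt (2 * ?F 0 / lam)"
  have F0: "?F 0 \<ge> 0"
    by (auto simp: ridge_obj_def intro!: sum_nonneg logistic_loss_nonneg divide_nonneg_nonneg)
  have cont: "continuous_on A ?F" for A
  proof -
    have "1 + exp t \<noteq> 0" for t :: real using exp_gt_zero[of t] by linarith
    then show ?thesis unfolding ridge_obj_def logistic_loss_def
      by (intro continuous_intros) auto
  qed
  obtain \<theta>' where \<theta>': "\<theta>' \<in> cball 0 B" "\<And>\<eta>. \<eta> \<in> cball 0 B \<Longrightarrow> ?F \<theta>' \<le> ?F \<eta>"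
  proof -
    have "cball (0 :: real ^ 'd) B \<noteq> {}" using F0 assms by (simp add: B_def divide_less_0_iff)
    then show ?thesis using continuous_attains_inf[OF compact_cball _ cont] that by metis
  qed
  have "?F \<theta>' \<le> ?F \<eta>" for \<eta>
  proof (cases "\<eta> \<in> cball 0 B")
    case False
    have "?F \<theta>' \<le> ?F 0" using \<theta>'(2)[of 0] F0 assms by (simp add: B_def)
    also have "\<dots> = lam / 2 * B\<^sup>2" using F0 assms by (simp add: B_def)
    also have "\<dots> \<le> lam / 2 * (norm \<eta>)\<^sup>2"
      using False assms F0 by (intro mult_left_mono power_mono) (auto simp: B_def)
    also have "\<dots> \<le> ?F \<eta>"
      by (auto simp: ridge_obj_def intro!: sum_nonneg logistic_loss_nonneg divide_nonneg_nonneg)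
    finally show ?thesis .
  qed (use \<theta>' in auto)
  then have "is_arg_min ?F (\<lambda>_. True) \<theta>'" by (auto simp: is_arg_min_def not_less)
  then have "is_arg_min ?F (\<lambda>_. True) (ridge_est lam n z)"
    unfolding ridge_est_def arg_min_def by (rule someI)
  then show ?thesis by (auto simp: is_arg_min_def not_less)
qed

lemma ridge_grad_est:
  assumes "lam > 0"
  shows "ridge_grad lam n z (ridge_est lam n z) = 0"
proof -
  define \<theta> where "\<theta> = ridge_est lam n z"
  \<comment> \<open>Moving in the direction of the gradient itself gives \<open>l\<close> the
    derivative \<open>v \<bullet> v\<close> at \<open>0\<close>, so one-variable calculus at the
    minimum forces \<open>v = 0\<close>.\<close>
  define v where "v = ridge_grad lam n z \<theta>"
  define l where "l t = (real n + 1) * ridge_obj lam n z (\<theta> + t *\<^sub>R v)" for t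
  have l_eq: "l t = (\<Sum>i\<le>n. logistic_loss (z i) (\<theta> + t *\<^sub>R v))
      + (real n + 1) * lam / 2 * (\<theta> \<bullet> \<theta> + 2 * t * (\<theta> \<bullet> v) + t * t * (v \<bullet> v))" for t
  proof -
    have "(norm (\<theta> + t *\<^sub>R v))\<^sup>2 = \<theta> \<bullet> \<theta> + 2 * t * (\<theta> \<bullet> v) + t * t * (v \<bullet> v)"
      by (simp add: power2_norm_eq_inner inner_add_left inner_add_right inner_commute)
    then show ?thesis by (simp add: l_def ridge_obj_def distrib_left[of "real n + 1"] del: distrib_left_numeral)
  qed
  have D: "((\<lambda>t. logistic_loss p (\<theta> + t *\<^sub>R v)) has_real_derivative
      - (snd p * sigmoid (- snd p * (\<theta> \<bullet> fst p))) * (fst p \<bullet> v)) (at 0)" for p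
  proof -
    have nz: "1 + exp t > 0" for t :: real using exp_gt_zero[of t] by linarith
    show ?thesis
      unfolding logistic_loss_def inner_add_left inner_scaleR_left
      by (rule derivative_eq_intros refl nz)+
         (use nz in \<open>simp add: sigmoid_def inner_commute divide_simps\<close>)
  qed
  have "(l has_real_derivative
      (\<Sum>i\<le>n. - (snd (z i) * sigmoid (- snd (z i) * (\<theta> \<bullet> fst (z i)))) * (fst (z i) \<bullet> v))
      + (real n + 1) * lam * (\<theta> \<bullet> v)) (at 0)" (is "(_ has_real_derivative ?l') _")
    unfolding l_eq[abs_def]
    by (rule D derivative_eq_intros refl)+ simp
  also have "?l' = ridge_grad lam n z \<theta> \<bullet> v"
    by (simp add: ridge_grad_def inner_diff_left inner_sum_left sum_negf)
  also have "\<dots> = v \<bullet> v" by (simp add: v_def)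
  finally have "(l has_real_derivative v \<bullet> v) (at 0)" .
  moreover have "\<forall>t. \<bar>0 - t\<bar> < 1 \<longrightarrow> l 0 \<le> l t"
    using ridge_est_is_min[OF assms, of n z] by (auto simp: l_def \<theta>_def intro!: mult_left_mono)
  ultimately have "v \<bullet> v = 0" by (rule DERIV_local_min[OF _ zero_less_one])
  then show ?thesis by (simp add: v_def \<theta>_def)
qed

text \<open>The penalty contributes the quadratic term exactly; each logistic loss is convex, so its
  gradient is monotone.\<close>

lemma ridge_grad_strongly_monotone:
  "(real n + 1) * lam * (norm (\<theta> - \<theta>'))\<^sup>2
     \<le> (ridge_grad lam n z \<theta> - ridge_grad lam n z \<theta>') \<bullet> (\<theta> - \<theta>')"
proof -
  \<comment> \<open>The factor \<open>s\<close> is an arbitrary real, so this bound, and with it the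
    continuity of the estimator, holds for all real labels.\<close>
  have *: "(s * sigmoid (- s * t) - s * sigmoid (- s * t')) * (t - t') \<le> 0" for s t t' :: real
  proof (cases "s * t \<le> s * t'")
    case True
    then have "sigmoid (- s * t') \<le> sigmoid (- s * t)" by (intro sigmoid_mono) simp
    then have "(sigmoid (- s * t) - sigmoid (- s * t')) * (s * t - s * t') \<le> 0"
      using True by (intro mult_nonneg_nonpos) auto
    then show ?thesis by (simp add: algebra_simps)
  next
    case False
    then have "sigmoid (- s * t) \<le> sigmoid (- s * t')" by (intro sigmoid_mono) simp
    then have "(sigmoid (- s * t) - sigmoid (- s * t')) * (s * t - s * t') \<le> 0"
      using False by (intro mult_nonpos_nonneg) auto
    then show ?thesis by (simp add: algebra_simps)
  qed
  have "(ridge_grad lam n z \<theta> - ridge_grad lam n z \<theta>') \<bullet> (\<theta> - \<theta>')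
    = (real n + 1) * lam * (norm (\<theta> - \<theta>'))\<^sup>2
      - (\<Sum>i\<le>n. (snd (z i) * sigmoid (- snd (z i) * (\<theta> \<bullet> fst (z i)))
          - snd (z i) * sigmoid (- snd (z i) * (\<theta>' \<bullet> fst (z i)))) * (\<theta> \<bullet> fst (z i) - \<theta>' \<bullet> fst (z i)))"
    unfolding ridge_grad_def power2_norm_eq_inner
    by (simp add: inner_diff_left inner_diff_right inner_sum_left inner_sum_right sum_subtractf sum.distrib
        algebra_simps inner_commute)
  moreover have "(\<Sum>i\<le>n. (snd (z i) * sigmoid (- snd (z i) * (\<theta> \<bullet> fst (z i)))
          - snd (z i) * sigmoid (- snd (z i) * (\<theta>' \<bullet> fst (z i)))) * (\<theta> \<bullet> fst (z i) - \<theta>' \<bullet> fst (z i))) \<le> 0"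
    by (intro sum_nonpos *)
  ultimately show ?thesis by linarith
qed

text \<open>Stability: the gradient vanishes at the estimator, so strong monotonicity and
  Cauchy-Schwarz turn a small gradient into a small distance.\<close>

lemma dist_ridge_est_le:
  assumes "lam > 0"
  shows "(real n + 1) * lam * norm (\<theta> - ridge_est lam n z) \<le> norm (ridge_grad lam n z \<theta>)"
proof (cases "\<theta> = ridge_est lam n z")
  case False
  let ?d = "\<theta> - ridge_est lam n z"
  have "(real n + 1) * lam * (norm ?d)\<^sup>2 \<le> ridge_grad lam n z \<theta> \<bullet> ?d"
    using ridge_grad_strongly_monotone[of n lam \<theta> "ridge_est lam n z" z]
    by (simp add: ridge_grad_est[OF assms])
  also have "\<dots> \<le> norm (ridge_grad lam n z \<theta>) * norm ?d" by (rule norm_cauchy_schwarz)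
  finally show ?thesis using False by (simp add: power2_eq_square)
qed simp

text \<open>Freeze the estimator of \<open>z\<close>. Its gradient under another sample
  \<open>z'\<close> is continuous in \<open>z'\<close>, vanishes at \<open>z' = z\<close>, and
  controls the distance to the estimator of \<open>z'\<close>.\<close>

lemma continuous_ridge_est:
  assumes "lam > 0"
  shows "continuous_on UNIV (ridge_est lam n)"
  unfolding continuous_on_def
proof safe
  fix z
  let ?\<theta> = "ridge_est lam n z" and ?c = "(real n + 1) * lam"
  have c: "?c > 0" using assms by simp
  have cont: "continuous_on UNIV (\<lambda>z'. norm (ridge_grad lam n z' ?\<theta>) / ?c)"
    unfolding ridge_grad_def
    by (intro continuous_intros continuous_on_product_coordinates) (use c in auto)
  have lim: "((\<lambda>z'. norm (ridge_grad lam n z' ?\<theta>) / ?c) \<longlongrightarrow> 0) (at z)"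
    using cont[unfolded continuous_on_def, rule_format, of z] by (simp add: ridge_grad_est[OF assms])
  have "((\<lambda>z'. ridge_est lam n z' - ?\<theta>) \<longlongrightarrow> 0) (at z)"
  proof (rule Lim_null_comparison[OF _ lim], intro always_eventually allI)
    fix z'
    show "norm (ridge_est lam n z' - ?\<theta>) \<le> norm (ridge_grad lam n z' ?\<theta>) / ?c"
      using dist_ridge_est_le[OF assms, of n ?\<theta> z'] c
      by (simp add: pos_le_divide_eq norm_minus_commute mult.commute)
  qed
  then show "(ridge_est lam n \<longlongrightarrow> ?\<theta>) (at z)" by (rule Lim_null[THEN iffD2])
qed

subsection \<open>Regret of the sample minmax predictor\<close>

text \<open>\<open>ridge_smp\<close> reads only the sample entries \<open>1, ..., n\<close>, so the
  test pair at index \<open>0\<close> stays out of the sample although all of \<open>z\<close> is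
  passed.\<close>

definition smp_loss :: "real \<Rightarrow> nat \<Rightarrow> (nat \<Rightarrow> (real ^ 'd) \<times> real) \<Rightarrow> real" where
  "smp_loss lam n z = - ln (ridge_smp lam n (\<lambda>i. fst (z i)) (\<lambda>i. snd (z i)) (snd (z 0)) (fst (z 0)))"

lemma smp_weight_eq:
  fixes z :: "nat \<Rightarrow> (real ^ 'd) \<times> real" and x :: "real ^ 'd" and y lam :: real and n :: nat
  defines "\<theta> \<equiv> ridge_est lam n (z(0 := (x, y)))"
  shows "smp_weight lam n (\<lambda>i. fst (z i)) (\<lambda>i. snd (z i)) y x
    = sigmoid (y * (\<theta> \<bullet> x)) * exp (- lam * (norm \<theta>)\<^sup>2 / 2)"
  by (simp add: smp_weight_def ridge_estimator_eq \<theta>_def Let_def)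

lemma smp_weight_pos: "0 < smp_weight lam n xs ys y x"
  by (simp add: smp_weight_def Let_def sigmoid_pos)

lemma smp_loss_nonneg:
  assumes "snd (z 0) \<in> {-1, 1}"
  shows "0 \<le> smp_loss lam n z"
proof -
  let ?w = "\<lambda>y. smp_weight lam n (\<lambda>i. fst (z i)) (\<lambda>i. snd (z i)) y (fst (z 0))"
  have "0 < ?w (snd (z 0))" "?w (snd (z 0)) \<le> ?w 1 + ?w (- 1)" "0 < ?w 1 + ?w (- 1)"
    using assms smp_weight_pos[of lam n _ _ _ "fst (z 0)"] by (auto intro: less_imp_le add_pos_pos)
  then show ?thesis by (simp add: smp_loss_def ridge_smp_def ln_le_zero_iff)
qed

text \<open>For \<open>s \<in> {-1, 1}\<close>,
  \<open>s * sigmoid (- s * t) = (1 + s) / 2 - sigmoid t\<close>, which moves all labels to the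
  right. Subtracting the equations for \<open>y = 1\<close> and \<open>y = - 1\<close> then leaves
  only the test point there.\<close>

lemma ridge_est_normal_equation:
  fixes z :: "nat \<Rightarrow> (real ^ 'd) \<times> real" and y lam :: real and n :: nat
  assumes "lam > 0" "\<And>i. i \<le> n \<Longrightarrow> snd (z i) \<in> {-1, 1}" "y \<in> {-1, 1}"
  defines "\<theta> \<equiv> ridge_est lam n (z(0 := (fst (z 0), y)))"
  shows "((real n + 1) * lam) *\<^sub>R \<theta> + (\<Sum>i\<le>n. sigmoid (\<theta> \<bullet> fst (z i)) *\<^sub>R fst (z i))
    = ((1 + y) / 2) *\<^sub>R fst (z 0) + (\<Sum>i<n. ((1 + snd (z (Suc i))) / 2) *\<^sub>R fst (z (Suc i)))"
proof -
  have lab: "s * sigmoid (- s * t) = (1 + s) / 2 - sigmoid t" if "s \<in> {-1, 1}" for s t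
    using that by (auto simp: sigmoid_minus algebra_simps)
  have "0 = ridge_grad lam n (z(0 := (fst (z 0), y))) \<theta>"
    by (simp add: \<theta>_def ridge_grad_est[OF \<open>lam > 0\<close>])
  also have "\<dots> = ((real n + 1) * lam) *\<^sub>R \<theta> - ((1 + y) / 2 - sigmoid (\<theta> \<bullet> fst (z 0))) *\<^sub>R fst (z 0)
      - (\<Sum>i<n. ((1 + snd (z (Suc i))) / 2 - sigmoid (\<theta> \<bullet> fst (z (Suc i)))) *\<^sub>R fst (z (Suc i)))"
    unfolding ridge_grad_def sum.atMost_shift
    using lab[OF \<open>y \<in> {-1, 1}\<close>] lab[OF assms(2)] by (simp add: Suc_le_eq del: mult_minus_left)
  finally show ?thesis
    by (simp add: sum.atMost_shift algebra_simps sum_subtractf sum.distrib)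
qed

text \<open>Here \<open>v\<close> is the inverse Hessian of \<open>(n + 1) * ridge_obj\<close> at
  \<theta>, applied to the test point. The last term is thus \<open>exp 1\<close> times the leverage
  of that point, and leverages sum to a trace.\<close>

lemma smp_loss_le:
  fixes z :: "nat \<Rightarrow> (real ^ 'd) \<times> real" and v :: "real ^ 'd" and lam R :: real and n :: nat
  assumes lam: "lam > 0" "lam \<ge> 2 * R\<^sup>2 / (real n + 1)"
    and z: "\<And>i. i \<le> n \<Longrightarrow> norm (fst (z i)) \<le> R" "\<And>i. i \<le> n \<Longrightarrow> snd (z i) \<in> {-1, 1}"
  defines "\<theta> \<equiv> ridge_est lam n z"
  assumes v: "((real n + 1) * lam) *\<^sub>R v
      + (\<Sum>j\<le>n. (sigmoid' (\<theta> \<bullet> fst (z j)) * (fst (z j) \<bullet> v)) *\<^sub>R fst (z j)) = fst (z 0)"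
  shows "smp_loss lam n z \<le> logistic_loss (z 0) \<theta> + lam / 2 * (norm \<theta>)\<^sup>2
    + exp 1 * (sigmoid' (\<theta> \<bullet> fst (z 0)) * (fst (z 0) \<bullet> v))"
proof -
  define x where "x i = fst (z i)" for i
  define m where "m = (real n + 1) * lam"
  define th where "th y = ridge_est lam n (z(0 := (x 0, y)))" for y
  define \<delta> where "\<delta> = th 1 - th (- 1)"
  define b where "b i = sigmoid' (\<theta> \<bullet> x i)" for i
  define s t where "s i = th 1 \<bullet> x i" and "t i = th (- 1) \<bullet> x i" for i
  have m: "m > 0" "m \<ge> 2 * R\<^sup>2" using lam by (simp_all add: m_def pos_divide_le_eq mult.commute)
  have \<theta>: "\<theta> = th (snd (z 0))" unfolding th_def \<theta>_def x_def by simp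
  have b_pos: "b i > 0" for i by (simp add: b_def sigmoid'_pos)
  have eq: "m *\<^sub>R \<delta> + (\<Sum>i\<le>n. (sigmoid (s i) - sigmoid (t i)) *\<^sub>R x i) = x 0"
    using ridge_est_normal_equation[where n = n and z = z and y = 1, OF lam(1) z(2)] ridge_est_normal_equation[where n = n and z = z and y = "- 1", OF lam(1) z(2)]
    by (simp add: \<delta>_def th_def x_def m_def s_def t_def algebra_simps sum_subtractf)
  have st: "s i - t i = x i \<bullet> \<delta>" for i
    by (simp add: s_def t_def \<delta>_def inner_diff_left inner_diff_right inner_commute)
  have mono: "0 \<le> (sigmoid (s i) - sigmoid (t i)) * (x i \<bullet> \<delta>)" for i
    unfolding st[symmetric] using sigmoid_mono[of "s i" "t i"] sigmoid_mono[of "t i" "s i"]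
    by (cases "s i \<le> t i") (auto intro: mult_nonpos_nonpos mult_nonneg_nonneg)
  have inner_eq: "m * (\<delta> \<bullet> \<delta>) + (\<Sum>i\<le>n. (sigmoid (s i) - sigmoid (t i)) * (x i \<bullet> \<delta>)) = x 0 \<bullet> \<delta>"
    using arg_cong[OF eq, of "\<lambda>u. u \<bullet> \<delta>"] by (simp add: inner_add_left inner_sum_left)
  \<comment> \<open>Both summands on the left of \<open>inner_eq\<close> are nonnegative, so either
    may be dropped.\<close>
  have x\<delta>: "0 \<le> x 0 \<bullet> \<delta>" and m\<delta>: "m * (\<delta> \<bullet> \<delta>) \<le> x 0 \<bullet> \<delta>"
    using inner_eq mult_nonneg_nonneg[OF less_imp_le[OF m(1)] inner_ge_zero[of \<delta>]]
      sum_nonneg[of "{..n}" "\<lambda>i. (sigmoid (s i) - sigmoid (t i)) * (x i \<bullet> \<delta>)", OF mono] by linarith+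
  have "m * norm \<delta> \<le> R"
  proof (cases "\<delta> = 0")
    case False
    have "m * (norm \<delta>)\<^sup>2 \<le> norm (x 0) * norm \<delta>"
      using m\<delta> norm_cauchy_schwarz[of "x 0" \<delta>] by (simp add: power2_norm_eq_inner)
    also have "\<dots> \<le> R * norm \<delta>" using z(1)[of 0] by (simp add: x_def mult_right_mono)
    finally show ?thesis using False by (simp add: power2_eq_square)
  qed (use z(1)[of 0] norm_ge_zero[of "fst (z 0)"] in \<open>simp; linarith\<close>)
  \<comment> \<open>The difference is at most \<open>R * norm \<delta>\<close>, hence at most
    \<open>R^2 / m\<close>; the lower bound on \<open>lam\<close> makes this at most
    \<open>1 / 2\<close>.\<close>
  then have "\<bar>s i - t i\<bar> \<le> 1 / 2" if "i \<le> n" for i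
  proof -
    have "R \<ge> 0" using z(1)[of 0] norm_ge_zero[of "fst (z 0)"] by linarith
    have "m * \<bar>x i \<bullet> \<delta>\<bar> \<le> m * (R * norm \<delta>)"
      using m(1) z(1)[OF that] Cauchy_Schwarz_ineq2[of "x i" \<delta>]
      by (intro mult_left_mono order_trans[OF Cauchy_Schwarz_ineq2] mult_right_mono) (auto simp: x_def)
    also have "\<dots> \<le> R * R"
      using \<open>m * norm \<delta> \<le> R\<close> \<open>R \<ge> 0\<close> mult_left_mono[of "m * norm \<delta>" R R] by (simp add: mult_ac)
    also have "\<dots> \<le> m * (1 / 2)" using m(2) by (simp add: power2_eq_square)
    finally show ?thesis using m(1) by (simp add: st)
  qed
  then have exp_half: "exp \<bar>s i - t i\<bar> \<le> exp (1 / 2)" if "i \<le> n" for i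
    using that by simp
  \<comment> \<open>\<theta> is \<open>th 1\<close> or \<open>th (- 1)\<close> according to the true
    label at index \<open>0\<close>, so \<open>b i\<close> is the derivative of the sigmoid at one
    of the ends \<open>s i\<close>, \<open>t i\<close>.\<close>
  have choice: "\<theta> \<bullet> x i = s i \<or> \<theta> \<bullet> x i = t i" for i
    using z(2)[of 0] by (auto simp: \<theta> s_def t_def)
  have slope_lower: "b i * (x i \<bullet> \<delta>)\<^sup>2 \<le> exp (1 / 2) * ((sigmoid (s i) - sigmoid (t i)) * (x i \<bullet> \<delta>))"
    and slope_upper: "(sigmoid (s i) - sigmoid (t i)) * (x i \<bullet> \<delta>) \<le> exp (1 / 2) * (b i * (x i \<bullet> \<delta>)\<^sup>2)"
    if "i \<le> n" for i
  proof -
    obtain a where a: "sigmoid (s i) - sigmoid (t i) = a * (s i - t i)"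
      "a \<le> exp \<bar>s i - t i\<bar> * b i" "b i \<le> exp \<bar>s i - t i\<bar> * a"
      using sigmoid_slope[of "s i" "t i"] choice[of i] unfolding b_def by metis
    have "a \<ge> 0" using a(3) b_pos[of i] by (metis exp_gt_zero less_le_trans less_imp_le zero_less_mult_pos)
    have "a \<le> exp (1 / 2) * b i" "b i \<le> exp (1 / 2) * a"
      using a(2,3) mult_right_mono[OF exp_half[OF that], of "b i"]
        mult_right_mono[OF exp_half[OF that] \<open>a \<ge> 0\<close>] b_pos[of i] by linarith+
    then have "a * (x i \<bullet> \<delta>)\<^sup>2 \<le> exp (1 / 2) * b i * (x i \<bullet> \<delta>)\<^sup>2"
      "b i * (x i \<bullet> \<delta>)\<^sup>2 \<le> exp (1 / 2) * a * (x i \<bullet> \<delta>)\<^sup>2"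
      by (auto intro: mult_right_mono)
    then show "b i * (x i \<bullet> \<delta>)\<^sup>2 \<le> exp (1 / 2) * ((sigmoid (s i) - sigmoid (t i)) * (x i \<bullet> \<delta>))"
      "(sigmoid (s i) - sigmoid (t i)) * (x i \<bullet> \<delta>) \<le> exp (1 / 2) * (b i * (x i \<bullet> \<delta>)\<^sup>2)"
      by (simp_all add: a(1) st power2_eq_square mult_ac)
  qed

  \<comment> \<open>The bilinear form of the Hessian at \<theta>; in it \<open>v\<close> represents
    the inner product with \<open>x 0\<close>.\<close>
  define Q where "Q u w = m * (u \<bullet> w) + (\<Sum>i\<le>n. b i * (x i \<bullet> u) * (x i \<bullet> w))" for u w
  have Qv: "Q v w = x 0 \<bullet> w" for w
    using arg_cong[OF v, of "\<lambda>u. u \<bullet> w"]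
    by (simp add: Q_def m_def b_def x_def inner_add_left inner_sum_left mult.assoc)
  have Q\<delta>: "Q \<delta> \<delta> \<le> exp (1 / 2) * (x 0 \<bullet> \<delta>)"
  proof -
    have "m * (\<delta> \<bullet> \<delta>) * 1 \<le> m * (\<delta> \<bullet> \<delta>) * exp (1 / 2)"
      using m(1) by (intro mult_left_mono) auto
    moreover have "(\<Sum>i\<le>n. b i * (x i \<bullet> \<delta>)\<^sup>2)
        \<le> exp (1 / 2) * (\<Sum>i\<le>n. (sigmoid (s i) - sigmoid (t i)) * (x i \<bullet> \<delta>))"
      unfolding sum_distrib_left using slope_lower by (intro sum_mono) auto
    ultimately show ?thesis
      unfolding inner_eq[symmetric] by (simp add: Q_def power2_eq_square algebra_simps)
  qed
  \<comment> \<open>The multiplier \<open>exp (- 1 / 2)\<close> minimises the quadratic bound that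
    results from inserting \<open>Q\<delta>\<close>.\<close>
  have "0 \<le> Q (v - exp (- 1 / 2) *\<^sub>R \<delta>) (v - exp (- 1 / 2) *\<^sub>R \<delta>)"
    using m(1) less_imp_le[OF b_pos] unfolding Q_def mult.assoc
    by (intro add_nonneg_nonneg sum_nonneg) auto
  also have "\<dots> = Q v v - 2 * exp (- 1 / 2) * Q v \<delta> + exp (- 1 / 2) * exp (- 1 / 2) * Q \<delta> \<delta>"
    by (simp add: Q_def inner_diff_left inner_diff_right inner_commute algebra_simps sum.distrib
        sum_subtractf sum_distrib_left)
  also have "\<dots> \<le> x 0 \<bullet> v - 2 * exp (- 1 / 2) * (x 0 \<bullet> \<delta>)
      + exp (- 1 / 2) * exp (- 1 / 2) * (exp (1 / 2) * (x 0 \<bullet> \<delta>))"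
    using Q\<delta> by (simp add: Qv mult_left_mono)
  also have "\<dots> = x 0 \<bullet> v - exp (- 1 / 2) * (x 0 \<bullet> \<delta>)"
    by (simp add: mult.assoc[symmetric] flip: exp_add)
  finally have xv: "exp (- 1 / 2) * (x 0 \<bullet> \<delta>) \<le> x 0 \<bullet> v" by simp
  \<comment> \<open>The slope comparison costs one factor \<open>exp (1 / 2)\<close> and
    \<open>xv\<close> the other; together they form the constant \<open>exp 1\<close>.\<close>
  have gap: "sigmoid (s 0) - sigmoid (t 0) \<le> exp 1 * (b 0 * (x 0 \<bullet> v))"
  proof -
    have "sigmoid (s 0) - sigmoid (t 0) \<le> exp (1 / 2) * (b 0 * (x 0 \<bullet> \<delta>))"
    proof (cases "x 0 \<bullet> \<delta> = 0")
      case True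
      then show ?thesis using st[of 0] by simp
    next
      case False
      then have "x 0 \<bullet> \<delta> > 0" using x\<delta> by simp
      then show ?thesis using slope_upper[of 0] by (simp add: power2_eq_square flip: mult.assoc)
    qed
    also have "x 0 \<bullet> \<delta> \<le> exp (1 / 2) * (x 0 \<bullet> v)"
      using mult_left_mono[OF xv, of "exp (1 / 2)"] by (simp flip: exp_add mult.assoc)
    also have "exp (1 / 2) * (b 0 * (exp (1 / 2) * (x 0 \<bullet> v))) = exp (1 / 2 + 1 / 2) * (b 0 * (x 0 \<bullet> v))"
      unfolding exp_add by simp
    finally show ?thesis using b_pos[of 0] by (simp add: mult_left_mono)
  qed

  define w where "w y = smp_weight lam n (\<lambda>i. fst (z i)) (\<lambda>i. snd (z i)) y (x 0)" for y
  have w_pos: "w y > 0" for y by (simp add: w_def smp_weight_pos)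
  have w_eq: "w y = sigmoid (y * (th y \<bullet> x 0)) * exp (- lam * (norm (th y))\<^sup>2 / 2)" for y
    unfolding w_def smp_weight_eq th_def by simp
  have w_le: "w y \<le> sigmoid (y * (th y \<bullet> x 0))" for y
    unfolding w_eq using lam(1) sigmoid_pos by (intro mult_left_le) (auto intro: less_imp_le)
  have "smp_loss lam n z = ln (w 1 + w (- 1)) - ln (w (snd (z 0)))"
    using w_pos add_pos_pos[OF w_pos[of 1] w_pos[of "- 1"]]
    by (simp add: smp_loss_def ridge_smp_def w_def x_def ln_div less_imp_neq[OF smp_weight_pos, symmetric])
  \<comment> \<open>The penalty factors are at most \<open>1\<close> and
    \<open>sigmoid (- t) = 1 - sigmoid t\<close>, so \<open>ln u \<le> u - 1\<close> bounds the log
    normaliser by a difference of sigmoids.\<close>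
  also have "ln (w 1 + w (- 1)) \<le> w 1 + w (- 1) - 1"
    by (intro ln_le_minus_one add_pos_pos w_pos)
  also have "w 1 + w (- 1) - 1 \<le> sigmoid (s 0) - sigmoid (t 0)"
    using w_le[of 1] w_le[of "- 1"] by (simp add: s_def t_def sigmoid_minus)
  also note gap
  also have "ln (w (snd (z 0))) = - logistic_loss (z 0) \<theta> - lam / 2 * (norm \<theta>)\<^sup>2"
    unfolding w_eq \<theta>[symmetric] logistic_loss_eq x_def by (simp add: ln_mult less_imp_neq[OF sigmoid_pos, symmetric])
  finally show ?thesis by (simp add: b_def x_def)
qed

text \<open>Swapping \<open>0\<close> and \<open>i\<close> makes pair \<open>i\<close> the test pair
  but leaves the full-sample estimator, and so the Hessian, unchanged. With \<theta> and
  \<open>k\<close> free, non-random choices make the right-hand side a sum of one fixed function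
  over the pairs.\<close>

lemma sum_smp_loss_le:
  fixes z :: "nat \<Rightarrow> (real ^ 'd) \<times> real" and k :: "real ^ 'd \<Rightarrow> real ^ 'd"
  assumes lam: "lam > 0" "lam \<ge> 2 * R\<^sup>2 / (real n + 1)"
    and z: "\<And>i. i \<le> n \<Longrightarrow> norm (fst (z i)) \<le> R" "\<And>i. i \<le> n \<Longrightarrow> snd (z i) \<in> {-1, 1}"
  shows "(\<Sum>i\<le>n. smp_loss lam n (z \<circ> Transposition.transpose 0 i))
    \<le> (\<Sum>i\<le>n. logistic_loss (z i) \<theta> + lam / 2 * (norm \<theta>)\<^sup>2
        + exp 1 / ((real n + 1) * lam)
          * (\<Sum>e\<in>Basis. (fst (z i) \<bullet> (e - k e))\<^sup>2 / 4 + lam * (norm (k e))\<^sup>2))"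
proof -
  define m where "m = (real n + 1) * lam"
  define x where "x i = fst (z i)" for i
  define b where "b i = sigmoid' (ridge_est lam n z \<bullet> x i)" for i
  have m: "m > 0" using lam by (simp add: m_def)
  have b: "0 \<le> b i" "b i \<le> 1 / 4" for i
    using sigmoid'_pos sigmoid'_le by (auto simp: b_def less_imp_le)
  have "\<exists>v. m *\<^sub>R v + (\<Sum>j\<le>n. (b j * (x j \<bullet> v)) *\<^sub>R x j) = w" for w
  proof (rule coercive_linear_surj[OF _ m])
    show "linear (\<lambda>v. m *\<^sub>R v + (\<Sum>j\<le>n. (b j * (x j \<bullet> v)) *\<^sub>R x j))"
      by (rule linearI) (simp_all add: inner_add_right algebra_simps sum.distrib scaleR_sum_right)
    fix v show "m * (norm v)\<^sup>2 \<le> (m *\<^sub>R v + (\<Sum>j\<le>n. (b j * (x j \<bullet> v)) *\<^sub>R x j)) \<bullet> v"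
      using b(1) by (auto simp: inner_add_left inner_sum_left power2_norm_eq_inner mult.assoc intro!: sum_nonneg)
  qed
  then have "\<forall>i. \<exists>v. m *\<^sub>R v + (\<Sum>j\<le>n. (b j * (x j \<bullet> v)) *\<^sub>R x j) = x i" by blast
  from choice[OF this] obtain v
    where v: "\<And>i. m *\<^sub>R v i + (\<Sum>j\<le>n. (b j * (x j \<bullet> v i)) *\<^sub>R x j) = x i" by blast
  let ?\<theta> = "ridge_est lam n z"
  have "(\<Sum>i\<le>n. smp_loss lam n (z \<circ> Transposition.transpose 0 i))
    \<le> (\<Sum>i\<le>n. logistic_loss (z i) ?\<theta> + lam / 2 * (norm ?\<theta>)\<^sup>2 + exp 1 * (b i * (x i \<bullet> v i)))"
  proof (rule sum_mono)
    fix i assume "i \<in> {..n}"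
    then have p: "Transposition.transpose 0 i permutes {..n}" by (simp add: permutes_swap_id)
    note in_p = permutes_in_image[OF p, simplified atMost_iff]
    have "(\<Sum>j\<le>n. (b (Transposition.transpose 0 i j) * (x (Transposition.transpose 0 i j) \<bullet> v i)) *\<^sub>R x (Transposition.transpose 0 i j))
      = (\<Sum>j\<le>n. (b j * (x j \<bullet> v i)) *\<^sub>R x j)"
      using sum.permute[OF p, of "\<lambda>j. (b j * (x j \<bullet> v i)) *\<^sub>R x j"] by (simp add: o_def)
    then have "((real n + 1) * lam) *\<^sub>R v i + (\<Sum>j\<le>n. (sigmoid' (ridge_est lam n (z \<circ> Transposition.transpose 0 i)
        \<bullet> fst ((z \<circ> Transposition.transpose 0 i) j)) * (fst ((z \<circ> Transposition.transpose 0 i) j) \<bullet> v i)) *\<^sub>R fst ((z \<circ> Transposition.transpose 0 i) j))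
        = fst ((z \<circ> Transposition.transpose 0 i) 0)"
      using v[of i] by (simp add: ridge_est_permute[OF p] b_def x_def m_def)
    from smp_loss_le[OF lam _ _ this] z in_p
    show "smp_loss lam n (z \<circ> Transposition.transpose 0 i)
      \<le> logistic_loss (z i) ?\<theta> + lam / 2 * (norm ?\<theta>)\<^sup>2 + exp 1 * (b i * (x i \<bullet> v i))"
      by (simp add: ridge_est_permute[OF p] b_def x_def)
  qed
  also have "\<dots> = (real n + 1) * ridge_obj lam n z ?\<theta> + exp 1 * (\<Sum>i\<le>n. b i * (x i \<bullet> v i))"
    by (simp add: ridge_obj_mult_Suc sum.distrib sum_distrib_left)
  also have "\<dots> \<le> (real n + 1) * ridge_obj lam n z \<theta>
      + exp 1 * (\<Sum>e\<in>Basis. (\<Sum>i\<le>n. b i * (x i \<bullet> (e - k e))\<^sup>2) / m + (norm (k e))\<^sup>2)"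
    by (intro add_mono mult_left_mono ridge_est_is_min[OF lam(1)] ridge_trace_le[OF m b(1) v]) auto
  \<comment> \<open>Bounding \<open>sigmoid'\<close> by \<open>1 / 4\<close> removes the last
    dependence on the estimator.\<close>
  also have "\<dots> \<le> (real n + 1) * ridge_obj lam n z \<theta>
      + exp 1 * (\<Sum>e\<in>Basis. (\<Sum>i\<le>n. 1 / 4 * (x i \<bullet> (e - k e))\<^sup>2) / m + (norm (k e))\<^sup>2)"
    using b(2) m by (intro add_left_mono mult_left_mono sum_mono add_mono divide_right_mono mult_right_mono) auto
  \<comment> \<open>As \<open>m = (n + 1) * lam\<close>, the term in \<open>norm (k e)\<close>
    splits into equal shares for the \<open>n + 1\<close> pairs.\<close>
  also have "(\<Sum>e\<in>Basis. (\<Sum>i\<le>n. 1 / 4 * (x i \<bullet> (e - k e))\<^sup>2) / m + (norm (k e))\<^sup>2)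
    = (\<Sum>e\<in>Basis. \<Sum>i\<le>n. ((x i \<bullet> (e - k e))\<^sup>2 / 4 + lam * (norm (k e))\<^sup>2) / m)"
    using lam(1) by (intro sum.cong refl) (simp add: add_divide_distrib sum.distrib sum_divide_distrib m_def add.commute[of 1])
  also have "\<dots> = (\<Sum>i\<le>n. (\<Sum>e\<in>Basis. (x i \<bullet> (e - k e))\<^sup>2 / 4 + lam * (norm (k e))\<^sup>2) / m)"
    by (subst sum.swap) (simp add: sum_divide_distrib)
  finally show ?thesis
    by (simp add: ridge_obj_mult_Suc sum.distrib sum_distrib_left x_def m_def o_def)
qed

section \<open>Dependence on finitely many pairs, and measurability of the loss\<close>

lemma smp_loss_cong:
  assumes "\<And>i. i \<le> n \<Longrightarrow> z i = z' i"
  shows "smp_loss lam n z = smp_loss lam n z'"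
proof -
  have "smp_weight lam n (\<lambda>i. fst (z i)) (\<lambda>i. snd (z i)) y x
      = smp_weight lam n (\<lambda>i. fst (z' i)) (\<lambda>i. snd (z' i)) y x" for y x
  proof -
    have "ridge_est lam n (z(0 := (x, y))) = ridge_est lam n (z'(0 := (x, y)))"
      using assms by (intro ridge_est_cong) auto
    then show ?thesis by (simp only: smp_weight_eq)
  qed
  then show ?thesis
    using assms[of 0] by (simp add: smp_loss_def ridge_smp_def)
qed

lemma smp_loss_upd:
  "smp_loss lam n ((\<lambda>i. (xs i, ys i))(0 := p)) = - ln (ridge_smp lam n xs ys (snd p) (fst p))"
proof -
  let ?z = "(\<lambda>i. (xs i, ys i))(0 := p)"
  have "smp_weight lam n (\<lambda>i. fst (?z i)) (\<lambda>i. snd (?z i)) y x = smp_weight lam n xs ys y x" for y x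
    unfolding smp_weight_eq by (simp only: smp_weight_def ridge_estimator_eq Let_def fun_upd_upd)
  then show ?thesis by (simp only: smp_loss_def ridge_smp_def fun_upd_same)
qed

lemma borel_measurable_smp_loss:
  assumes "lam > 0"
  shows "(smp_loss lam n :: (nat \<Rightarrow> (real ^ 'd) \<times> real) \<Rightarrow> real) \<in> borel_measurable borel"
proof -
  have est: "continuous_on UNIV (\<lambda>z. ridge_est lam n (z(0 := (fst (z 0), f z))))"
    if "continuous_on UNIV f" for f :: "(nat \<Rightarrow> (real ^ 'd) \<times> real) \<Rightarrow> real"
  proof (rule continuous_on_compose2[OF continuous_ridge_est[OF assms] _ subset_UNIV])
    show "continuous_on UNIV (\<lambda>z. z(0 := (fst (z 0), f z)))"
    proof (rule continuous_on_coordinatewise_then_product)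
      fix i show "continuous_on UNIV (\<lambda>z. (z(0 := (fst (z 0), f z))) i)"
        by (cases "i = 0") (auto intro!: continuous_intros that)
    qed
  qed
  have w: "continuous_on UNIV (\<lambda>z :: nat \<Rightarrow> (real ^ 'd) \<times> real.
      smp_weight lam n (\<lambda>i. fst (z i)) (\<lambda>i. snd (z i)) (f z) (fst (z 0)))"
    if "continuous_on UNIV f" for f
    unfolding smp_weight_eq by (intro continuous_intros est that) auto
  have "smp_weight lam n xs ys y x \<noteq> 0"
    "smp_weight lam n xs ys y x + smp_weight lam n xs ys y' x \<noteq> 0" for xs :: "nat \<Rightarrow> real ^ 'd" and ys y y' x
    using smp_weight_pos[of lam n xs ys y x] smp_weight_pos[of lam n xs ys y' x] by linarith+
  then have "continuous_on UNIV (smp_loss lam n :: (nat \<Rightarrow> (real ^ 'd) \<times> real) \<Rightarrow> real)"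
    unfolding smp_loss_def[abs_def] ridge_smp_def
    by (intro continuous_intros w continuous_on_product_coordinates) auto
  then show ?thesis by (rule borel_measurable_continuous_onI)
qed

subsection \<open>Exchangeability\<close>

lemma integrable_continuous_compact:
  fixes F :: "'b::topological_space \<Rightarrow> 'c::{banach, second_countable_topology}"
  assumes "finite_measure M" "U \<in> borel_measurable M" "continuous_on UNIV F"
    and "compact K" "AE \<omega> in M. U \<omega> \<in> K"
  shows "integrable M (\<lambda>\<omega>. F (U \<omega>))"
proof -
  interpret finite_measure M by fact
  have "bounded (F ` K)"
    using assms(3,4) by (intro compact_imp_bounded compact_continuous_image) (auto intro: continuous_on_subset)
  then obtain B where "\<And>x. x \<in> K \<Longrightarrow> norm (F x) \<le> B" by (auto simp: bounded_iff)
  then show ?thesis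
    using assms(2,3,5) borel_measurable_continuous_onI[OF assms(3)]
    by (intro integrable_const_bound[of _ B]) (auto elim: eventually_mono)
qed

text \<open>The product measure is invariant under swapping coordinates, so every summand on the
  left of \<open>le\<close> integrates to the integral of \<open>g\<close>, and every one on the
  right to that of \<open>f\<close>.\<close>

lemma leave_one_out_expectation:
  fixes P :: "'b::second_countable_topology measure" and g :: "(nat \<Rightarrow> 'b) \<Rightarrow> real"
  assumes P: "prob_space P" and [measurable_cong]: "sets P = sets borel"
    and g: "g \<in> borel_measurable borel"
    and cong: "\<And>z z'. (\<And>i. i \<le> n \<Longrightarrow> z i = z' i) \<Longrightarrow> g z = g z'"
    and A: "AE p in P. p \<in> A"
    and nonneg: "\<And>z. (\<And>i. i \<le> n \<Longrightarrow> z i \<in> A) \<Longrightarrow> 0 \<le> g z"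
    and le: "\<And>z. (\<And>i. i \<le> n \<Longrightarrow> z i \<in> A) \<Longrightarrow>
      (\<Sum>i\<le>n. g (z \<circ> Transposition.transpose 0 i)) \<le> (\<Sum>i\<le>n. f (z i))"
    and f: "integrable P f"
  shows "integrable (Pi\<^sub>M {..n} (\<lambda>_. P)) g" (is "integrable ?Q _")
    and "(\<integral>z. g z \<partial>Pi\<^sub>M {..n} (\<lambda>_. P)) \<le> (\<integral>p. f p \<partial>P)"
proof -
  let ?\<tau> = "Transposition.transpose (0 :: nat)"
  \<comment> \<open>Coordinates above \<open>n\<close> are constantly \<open>undefined\<close> on
    this product space, hence measurable.\<close>
  have "(\<lambda>z. z) \<in> ?Q \<rightarrow>\<^sub>M borel"
  proof (rule measurable_coordinatewise_then_product)
    fix i show "(\<lambda>z. z i) \<in> borel_measurable ?Q"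
    proof (cases "i \<le> n")
      case False
      then have "z i = undefined" if "z \<in> space ?Q" for z
        using that by (auto simp: space_PiM PiE_def extensional_def)
      then show ?thesis by (subst measurable_cong[of _ _ "\<lambda>_. undefined"]) auto
    qed measurable
  qed
  then have gQ [measurable]: "g \<in> borel_measurable ?Q" using measurable_compose[OF _ g] by blast
  have fP [measurable]: "f \<in> borel_measurable P" using f by simp
  have AQ: "AE z in ?Q. \<forall>i\<in>{..n}. z i \<in> A"
    by (intro AE_finite_allI finite_atMost AE_PiM_component P A)
  have comp: "integrable ?Q (\<lambda>z. f (z i))" "(\<integral>z. f (z i) \<partial>?Q) = (\<integral>p. f p \<partial>P)" if "i \<le> n" for i
  proof -
    have d: "distr ?Q P (\<lambda>z. z i) = P" using that by (intro distr_PiM_component P) auto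
    have [measurable]: "(\<lambda>z. z i) \<in> ?Q \<rightarrow>\<^sub>M P"
      using that by (intro measurable_component_singleton) auto
    show "integrable ?Q (\<lambda>z. f (z i))" using f integrable_distr[of "\<lambda>z. z i" ?Q P f] by (simp add: d)
    show "(\<integral>z. f (z i) \<partial>?Q) = (\<integral>p. f p \<partial>P)" using integral_distr[of "\<lambda>z. z i" ?Q P f] by (simp add: d)
  qed
  have \<tau>: "?\<tau> i permutes {..n}" if "i \<le> n" for i using that by (simp add: permutes_swap_id)
  have exch: "distr ?Q ?Q (\<lambda>z. \<lambda>j\<in>{..n}. z (?\<tau> i j)) = ?Q" if "i \<le> n" for i
    using distr_PiM_reindex[of "{..n}" "\<lambda>_. P" "?\<tau> i" "{..n}"] permutes_inj_on[OF \<tau>[OF that]]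
      permutes_in_image[OF \<tau>[OF that]] P by auto
  have g_restrict: "g (\<lambda>j\<in>{..n}. z (?\<tau> i j)) = g (z \<circ> ?\<tau> i)" for z i
    by (rule cong) simp
  have m\<tau>: "(\<lambda>z. \<lambda>j\<in>{..n}. z (?\<tau> i j)) \<in> ?Q \<rightarrow>\<^sub>M ?Q" if "i \<le> n" for i
    using permutes_in_image[OF \<tau>[OF that]] by (intro measurable_restrict measurable_component_singleton) auto
  \<comment> \<open>Swapping \<open>0\<close> with itself is the identity, so \<open>g z\<close> is
    one of the nonnegative summands and is dominated by the sum of the
    \<open>f (z i)\<close>.\<close>
  show int_g: "integrable ?Q g"
  proof (rule Bochner_Integration.integrable_bound[OF _ gQ])
    show "integrable ?Q (\<lambda>z. \<Sum>i\<le>n. f (z i))" using comp by (intro Bochner_Integration.integrable_sum) auto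
    show "AE z in ?Q. norm (g z) \<le> norm (\<Sum>i\<le>n. f (z i))"
    proof (rule eventually_mono[OF AQ])
      fix z assume z: "\<forall>i\<in>{..n}. z i \<in> A"
      have "0 \<le> g (z \<circ> ?\<tau> i)" if "i \<le> n" for i
        using z permutes_in_image[OF \<tau>[OF that]] by (intro nonneg) auto
      then have "g (z \<circ> ?\<tau> 0) \<le> (\<Sum>i\<le>n. g (z \<circ> ?\<tau> i))"
        by (intro member_le_sum) auto
      also have "\<dots> \<le> (\<Sum>i\<le>n. f (z i))" using z by (intro le) auto
      finally have "g z \<le> (\<Sum>i\<le>n. f (z i))" by simp
      moreover have "0 \<le> g z" using z by (intro nonneg) auto
      ultimately show "norm (g z) \<le> norm (\<Sum>i\<le>n. f (z i))" by simp
    qed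
  qed
  have g_comp: "integrable ?Q (\<lambda>z. g (z \<circ> ?\<tau> i))" "(\<integral>z. g (z \<circ> ?\<tau> i) \<partial>?Q) = (\<integral>z. g z \<partial>?Q)" if "i \<le> n" for i
    using integrable_distr[OF m\<tau>[OF that], of g] integral_distr[OF m\<tau>[OF that] gQ] int_g
    by (simp_all add: exch[OF that] g_restrict)
  have "(real n + 1) * (\<integral>z. g z \<partial>?Q) = (\<Sum>i\<le>n. \<integral>z. g (z \<circ> ?\<tau> i) \<partial>?Q)" using g_comp by simp
  also have "\<dots> = (\<integral>z. (\<Sum>i\<le>n. g (z \<circ> ?\<tau> i)) \<partial>?Q)"
    using g_comp by (subst Bochner_Integration.integral_sum) auto
  also have "\<dots> \<le> (\<integral>z. (\<Sum>i\<le>n. f (z i)) \<partial>?Q)"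
    using AQ comp g_comp
    by (intro integral_mono_AE Bochner_Integration.integrable_sum) (auto elim!: eventually_mono intro!: le)
  also have "\<dots> = (\<Sum>i\<le>n. \<integral>z. f (z i) \<partial>?Q)"
    using comp by (subst Bochner_Integration.integral_sum) auto
  also have "\<dots> = (real n + 1) * (\<integral>p. f p \<partial>P)" using comp by simp
  finally show "(\<integral>z. g z \<partial>?Q) \<le> (\<integral>p. f p \<partial>P)" by simp
qed

text \<open>The inner integral averages \<open>Z 0\<close> on its own, and the outer one sees only
  indices \<open>1, ..., n\<close>, since index \<open>0\<close> is overwritten. Independence and
  Fubini then yield the product law.\<close>

lemma (in prob_space) expectation_fresh_test_point:
  fixes Z :: "nat \<Rightarrow> 'a \<Rightarrow> 'b::second_countable_topology" and g :: "(nat \<Rightarrow> 'b) \<Rightarrow> real"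
  defines "P \<equiv> distr M borel (Z 0)"
  assumes "n \<ge> 1" and indep: "indep_vars (\<lambda>_. borel) Z {0..n}"
    and distr: "\<And>i. i \<le> n \<Longrightarrow> distr M borel (Z i) = P"
    and g: "g \<in> borel_measurable borel" "integrable (Pi\<^sub>M {..n} (\<lambda>_. P)) g"
    and cong: "\<And>z z'. (\<And>i. i \<le> n \<Longrightarrow> z i = z' i) \<Longrightarrow> g z = g z'"
  shows "(\<integral>\<omega>. (\<integral>\<omega>'. g ((\<lambda>i. Z i \<omega>)(0 := Z 0 \<omega>')) \<partial>M) \<partial>M) = (\<integral>z. g z \<partial>Pi\<^sub>M {..n} (\<lambda>_. P))"
proof -
  have Z: "random_variable borel (Z i)" if "i \<le> n" for i
    using indep that by (auto simp: indep_vars_def)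
  have P: "prob_space P" unfolding P_def by (intro prob_space_distr Z) simp
  have [measurable_cong]: "sets P = sets borel" by (simp add: P_def)
  let ?Q = "Pi\<^sub>M {1..n} (\<lambda>_. P)" and ?rZ = "\<lambda>\<omega>. \<lambda>i\<in>{1..n}. Z i \<omega>"
  define h where "h z = (\<integral>p. g (z(0 := p)) \<partial>P)" for z
  have "(\<lambda>(z, p). z(0 := p)) \<in> ?Q \<Otimes>\<^sub>M P \<rightarrow>\<^sub>M borel"
  proof (rule measurable_coordinatewise_then_product)
    fix i :: nat
    consider "i = 0" | "i \<in> {1..n}" | "i > n" by force
    then show "(\<lambda>x. (case x of (z, p) \<Rightarrow> z(0 := p)) i) \<in> borel_measurable (?Q \<Otimes>\<^sub>M P)"
    proof cases
      case 3
      then have "(case x of (z, p) \<Rightarrow> z(0 := p)) i = undefined" if "x \<in> space (?Q \<Otimes>\<^sub>M P)" for x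
        using that by (auto simp: space_pair_measure space_PiM PiE_def extensional_def)
      then show ?thesis by (subst measurable_cong[of _ _ "\<lambda>_. undefined"]) auto
    qed (auto simp: split_beta' cong: measurable_cong)
  qed
  then have "(\<lambda>(z, p). g (z(0 := p))) \<in> borel_measurable (?Q \<Otimes>\<^sub>M P)"
    using measurable_compose[OF _ g(1)] by (simp add: split_beta')
  then have h: "h \<in> borel_measurable ?Q"
    unfolding h_def by (intro sigma_finite_measure.borel_measurable_lebesgue_integral
      prob_space_imp_sigma_finite P)
  have upd: "(\<lambda>p. z(0 := p)) \<in> borel \<rightarrow>\<^sub>M borel" for z :: "nat \<Rightarrow> 'b"
    by (rule measurable_coordinatewise_then_product) (simp add: fun_upd_def)
  have inner: "(\<integral>\<omega>'. g (z(0 := Z 0 \<omega>')) \<partial>M) = h (\<lambda>i\<in>{1..n}. z i)" for z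
  proof -
    have "(\<integral>\<omega>'. g (z(0 := Z 0 \<omega>')) \<partial>M) = h z"
      unfolding h_def P_def
      using measurable_compose[OF upd g(1)] by (subst integral_distr[OF Z]) auto
    also have "\<dots> = h (\<lambda>i\<in>{1..n}. z i)"
      unfolding h_def by (intro Bochner_Integration.integral_cong refl cong) auto
    finally show ?thesis .
  qed
  \<comment> \<open>Independence of the sample says that its joint law is a product;
    \<open>n \<ge> 1\<close> makes the index set nonempty.\<close>
  have "distr M (Pi\<^sub>M {1..n} (\<lambda>_. borel)) ?rZ = (\<Pi>\<^sub>M i\<in>{1..n}. distr M borel (Z i))"
    using indep_vars_subset[OF indep, of "{1..n}"] \<open>n \<ge> 1\<close> Z
    by (intro indep_vars_iff_distr_eq_PiM'[THEN iffD1]) auto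
  also have "\<dots> = ?Q" by (intro PiM_cong) (auto simp: distr)
  finally have law: "distr M (Pi\<^sub>M {1..n} (\<lambda>_. borel)) ?rZ = ?Q" .
  have rZ: "?rZ \<in> M \<rightarrow>\<^sub>M Pi\<^sub>M {1..n} (\<lambda>_. borel)"
    using Z by (intro measurable_restrict) auto
  have sQ: "sets ?Q = sets (Pi\<^sub>M {1..n} (\<lambda>_. borel))" by (intro sets_PiM_cong) (auto simp: P_def)
  have "(\<integral>\<omega>. (\<integral>\<omega>'. g ((\<lambda>i. Z i \<omega>)(0 := Z 0 \<omega>')) \<partial>M) \<partial>M) = (\<integral>\<omega>. h (?rZ \<omega>) \<partial>M)"
    by (simp add: inner)
  also have "\<dots> = (\<integral>z. h z \<partial>?Q)"
    using h measurable_cong_sets[OF sQ refl] by (subst law[symmetric], subst integral_distr[OF rZ]) auto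
  also have "\<dots> = (\<integral>z. g z \<partial>Pi\<^sub>M (insert 0 {1..n}) (\<lambda>_. P))"
  proof -
    interpret product_sigma_finite "\<lambda>_. P"
      by (simp add: product_sigma_finite_def prob_space_imp_sigma_finite[OF P])
    have "insert 0 {1..n} = {..n}" by auto
    then show ?thesis unfolding h_def
      using g(2) by (subst product_integral_insert) auto
  qed
  also have "insert 0 {1..n} = {..n}" by auto
  finally show ?thesis .
qed

section \<open>The population second moment and assembly of the bound\<close>

lemma second_moment_inner:
  fixes U :: "'a \<Rightarrow> real ^ 'd"
  assumes M: "finite_measure M" and U: "U \<in> borel_measurable M" "AE \<omega> in M. norm (U \<omega>) \<le> R"
  shows "(second_moment M U *v u) \<bullet> w = (\<integral>\<omega>. (U \<omega> \<bullet> u) * (U \<omega> \<bullet> w) \<partial>M)"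
proof -
  define F :: "real ^ 'd \<Rightarrow> real ^ 'd ^ 'd" where "F x = (\<chi> i j. x $ i * x $ j)" for x
  have "continuous_on UNIV F"
    unfolding F_def by (intro continuous_on_vec_lambda continuous_intros)
  then have int: "integrable M (\<lambda>\<omega>. F (U \<omega>))"
    using U(2) by (intro integrable_continuous_compact[OF M U(1), where K = "cball 0 R"]) auto
  have "linear (\<lambda>A :: real ^ 'd ^ 'd. (A *v u) \<bullet> w)"
    by (rule linearI) (simp_all add: matrix_vector_mult_add_rdistrib inner_add_left scaleR_matrix_vector_assoc[symmetric])
  then have "(\<integral>\<omega>. (F (U \<omega>) *v u) \<bullet> w \<partial>M) = ((\<integral>\<omega>. F (U \<omega>) \<partial>M) *v u) \<bullet> w"
    by (intro integral_bounded_linear int) (simp add: linear_conv_bounded_linear)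
  moreover have "F x *v u = (x \<bullet> u) *\<^sub>R x" for x
    by (simp add: F_def vec_eq_iff matrix_vector_mult_def inner_vec_def sum_distrib_left mult_ac)
  ultimately show ?thesis by (simp add: second_moment_def F_def)
qed

theorem theorem6:
  fixes M :: "'a measure"
    and X :: "nat \<Rightarrow> 'a \<Rightarrow> real ^ 'd"
    and Y :: "nat \<Rightarrow> 'a \<Rightarrow> real"
    and n :: nat
    and R lam :: real
  assumes "prob_space M"
    and "n \<ge> 1"
    and "\<And>i \<omega>. i \<le> n \<Longrightarrow> \<omega> \<in> space M \<Longrightarrow> Y i \<omega> \<in> {-1, 1}"
    \<comment> \<open>index 0 is the test pair, indices 1 to n are the sample\<close>
    and "prob_space.indep_vars M (\<lambda>_. borel) (\<lambda>i \<omega>. (X i \<omega>, Y i \<omega>)) {0..n}"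
    and "\<And>i. i \<le> n \<Longrightarrow>
      distr M borel (\<lambda>\<omega>. (X i \<omega>, Y i \<omega>)) = distr M borel (\<lambda>\<omega>. (X 0 \<omega>, Y 0 \<omega>))"
    and "R > 0"
    and "AE \<omega> in M. norm (X 0 \<omega>) \<le> R"
    and "lam \<ge> 2 * R\<^sup>2 / (real n + 1)"
  shows "(\<integral>\<omega>. risk M (X 0) (Y 0) (ridge_smp lam n (\<lambda>i. X i \<omega>) (\<lambda>i. Y i \<omega>)) \<partial>M)
       - (INF \<theta>. risk M (X 0) (Y 0) (logistic_model \<theta>) + lam / 2 * (norm \<theta>)\<^sup>2)
       \<le> exp 1 * (deg_freedom (4 * lam) (second_moment M (X 0)) / real n)"
proof -
  interpret prob_space M by fact
  have "lam > 0" using \<open>R > 0\<close> \<open>lam \<ge> 2 * R\<^sup>2 / (real n + 1)\<close>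
    by (smt (verit) divide_pos_pos of_nat_0_le_iff zero_less_power)
  define Z where "Z i \<omega> = (X i \<omega>, Y i \<omega>)" for i \<omega>
  define P where "P = distr M borel (Z 0)"
  \<comment> \<open>The test pair lies in this compact set almost surely, so continuous functions of
    it are integrable.\<close>
  define A where "A = cball (0 :: real ^ 'd) R \<times> {-1, 1 :: real}"
  define S where "S = second_moment M (X 0)"
  define df where "df = deg_freedom (4 * lam) S"
  \<comment> \<open>Cancelling \<open>4\<close>, this is \<open>(S / 4 + lam)^(-1) (S / 4)\<close>,
    the optimal \<open>k\<close> once \<open>sigmoid'\<close> is replaced by \<open>1 / 4\<close>;
    hence the parameter \<open>4 * lam\<close>.\<close>
  define k where "k e = (matrix_inv (S + (4 * lam) *\<^sub>R mat 1) ** S) *v e" for e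
  define f where "f \<theta> p = logistic_loss p \<theta> + lam / 2 * (norm \<theta>)\<^sup>2
      + exp 1 / ((real n + 1) * lam) * (\<Sum>e\<in>Basis. (fst p \<bullet> (e - k e))\<^sup>2 / 4 + lam * (norm (k e))\<^sup>2)" for \<theta> p
  have indep: "indep_vars (\<lambda>_. borel) Z {0..n}" using assms(4) unfolding Z_def[abs_def] .
  then have Z: "Z 0 \<in> borel_measurable M" by (auto simp: indep_vars_def)
  have "X 0 = fst \<circ> Z 0" by (simp add: fun_eq_iff Z_def)
  then have X: "X 0 \<in> borel_measurable M"
    using Z by (simp add: borel_measurable_continuous_onI continuous_on_fst measurable_comp)
  have "compact A" unfolding A_def by (intro compact_Times) auto
  then have A_borel: "A \<in> sets borel" by (intro borel_closed compact_imp_closed)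
  have AZ: "AE \<omega> in M. Z 0 \<omega> \<in> A"
    using assms(7) AE_space by eventually_elim (use assms(3)[of 0] in \<open>auto simp: A_def Z_def\<close>)
  then have AP: "AE p in P. p \<in> A"
    unfolding P_def using A_borel by (subst AE_distr_iff[OF Z]) auto
  have nz: "1 + exp t \<noteq> 0" for t :: real using exp_gt_zero[of t] by linarith
  have int_Z: "integrable M (\<lambda>\<omega>. G (Z 0 \<omega>))" if "continuous_on UNIV G" for G :: "_ \<Rightarrow> real"
    using that \<open>compact A\<close> AZ by (intro integrable_continuous_compact[OF finite_measure_axioms Z])
  have cont_loss: "continuous_on UNIV (\<lambda>p. logistic_loss p \<theta>)" for \<theta> :: "real ^ 'd"
    unfolding logistic_loss_def by (intro continuous_intros) (auto simp: nz)
  have cont_f: "continuous_on UNIV (f \<theta>)" for \<theta>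
    unfolding f_def by (intro continuous_intros cont_loss) auto
  have S: "(S *v u) \<bullet> w = (\<integral>\<omega>. (X 0 \<omega> \<bullet> u) * (X 0 \<omega> \<bullet> w) \<partial>M)" for u w
    unfolding S_def by (rule second_moment_inner[OF finite_measure_axioms X assms(7)])
  have Sk: "S *v (e - k e) = (4 * lam) *\<^sub>R k e" for e
    unfolding k_def using \<open>lam > 0\<close> by (intro ridge_projection_eq) (simp_all add: S)
  have df: "df = (\<Sum>e\<in>Basis. e \<bullet> k e)"
    by (simp add: df_def deg_freedom_def trace_eq_sum_Basis k_def)
  \<comment> \<open>By \<open>Sk\<close> the first summand integrates to
    \<open>lam * (k e \<bullet> (e - k e))\<close>, whose part quadratic in \<open>k e\<close>
    cancels the penalty.\<close>
  have basis_term: "(\<integral>\<omega>. (X 0 \<omega> \<bullet> (e - k e))\<^sup>2 / 4 + lam * (norm (k e))\<^sup>2 \<partial>M) = lam * (e \<bullet> k e)" for e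
  proof -
    have "integrable M (\<lambda>\<omega>. (X 0 \<omega> \<bullet> (e - k e))\<^sup>2)"
      using int_Z[of "\<lambda>p. (fst p \<bullet> (e - k e))\<^sup>2"] by (simp add: Z_def continuous_intros)
    then have "(\<integral>\<omega>. (X 0 \<omega> \<bullet> (e - k e))\<^sup>2 / 4 + lam * (norm (k e))\<^sup>2 \<partial>M)
      = (S *v (e - k e)) \<bullet> (e - k e) / 4 + lam * (norm (k e))\<^sup>2"
      by (simp add: S power2_eq_square prob_space)
    also have "\<dots> = lam * (e \<bullet> k e)"
      unfolding Sk by (simp add: power2_norm_eq_inner inner_diff_right inner_commute algebra_simps diff_divide_distrib)
    finally show ?thesis .
  qed
  \<comment> \<open>The sign of \<open>df\<close> is read off from the integrals just computed,
    whose integrands are nonnegative.\<close>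
  have "0 \<le> lam * (e \<bullet> k e)" for e
    unfolding basis_term[symmetric] using \<open>lam > 0\<close> by (intro integral_nonneg_AE) auto
  then have "df \<ge> 0" using \<open>lam > 0\<close> unfolding df by (intro sum_nonneg) (simp add: zero_le_mult_iff)
  have int_f: "(\<integral>p. f \<theta> p \<partial>P)
    = risk M (X 0) (Y 0) (logistic_model \<theta>) + lam / 2 * (norm \<theta>)\<^sup>2 + exp 1 * df / (real n + 1)" for \<theta>
  proof -
    have "(\<integral>p. f \<theta> p \<partial>P) = (\<integral>\<omega>. f \<theta> (Z 0 \<omega>) \<partial>M)"
      unfolding P_def by (intro integral_distr Z borel_measurable_continuous_onI cont_f)
    also have "\<dots> = (\<integral>\<omega>. logistic_loss (Z 0 \<omega>) \<theta> \<partial>M) + lam / 2 * (norm \<theta>)\<^sup>2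
      + exp 1 / ((real n + 1) * lam)
        * (\<Sum>e\<in>Basis. \<integral>\<omega>. (fst (Z 0 \<omega>) \<bullet> (e - k e))\<^sup>2 / 4 + lam * (norm (k e))\<^sup>2 \<partial>M)"
    proof -
      have 1: "integrable M (\<lambda>\<omega>. logistic_loss (Z 0 \<omega>) \<theta>)" by (rule int_Z[OF cont_loss])
      have 2: "integrable M (\<lambda>\<omega>. (fst (Z 0 \<omega>) \<bullet> (e - k e))\<^sup>2 / 4 + lam * (norm (k e))\<^sup>2)" for e
        by (rule int_Z) (intro continuous_intros; simp)
      show ?thesis
        unfolding f_def
        by (subst Bochner_Integration.integral_sum[symmetric], rule 2)
           (simp add: 1 2 prob_space del: Bochner_Integration.integral_sum)
    qed
    also have "(\<integral>\<omega>. logistic_loss (Z 0 \<omega>) \<theta> \<partial>M) = risk M (X 0) (Y 0) (logistic_model \<theta>)"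
      by (simp add: risk_def logistic_loss_eq logistic_model_def Z_def)
    also have "exp 1 / ((real n + 1) * lam)
        * (\<Sum>e\<in>Basis. \<integral>\<omega>. (fst (Z 0 \<omega>) \<bullet> (e - k e))\<^sup>2 / 4 + lam * (norm (k e))\<^sup>2 \<partial>M)
        = exp 1 * df / (real n + 1)"
      using \<open>lam > 0\<close> by (simp add: Z_def basis_term df flip: sum_distrib_left)
    finally show ?thesis .
  qed
  have regret: "(\<Sum>i\<le>n. smp_loss lam n (z \<circ> Transposition.transpose 0 i)) \<le> (\<Sum>i\<le>n. f \<theta> (z i))"
    if "\<And>i. i \<le> n \<Longrightarrow> z i \<in> A" for z \<theta>
    unfolding f_def using that \<open>lam > 0\<close> assms(8)
    by (intro sum_smp_loss_le) (auto simp: A_def mem_Times_iff)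
  have nonneg: "0 \<le> smp_loss lam n z" if "\<And>i. i \<le> n \<Longrightarrow> z i \<in> A" for z :: "nat \<Rightarrow> (real ^ 'd) \<times> real"
    using that[of 0] by (intro smp_loss_nonneg) (auto simp: A_def mem_Times_iff)
  have "prob_space P" unfolding P_def by (rule prob_space_distr[OF Z])
  have int_f': "integrable P (f \<theta>)" for \<theta>
    unfolding P_def
    by (subst integrable_distr_eq[OF Z borel_measurable_continuous_onI[OF cont_f]]) (rule int_Z[OF cont_f])
  have sets_P: "sets P = sets borel" by (simp add: P_def)
  note loo = leave_one_out_expectation[OF \<open>prob_space P\<close> sets_P borel_measurable_smp_loss[OF \<open>lam > 0\<close>]
      smp_loss_cong AP nonneg regret int_f']
  have "(\<integral>\<omega>. risk M (X 0) (Y 0) (ridge_smp lam n (\<lambda>i. X i \<omega>) (\<lambda>i. Y i \<omega>)) \<partial>M)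
    = (\<integral>\<omega>. (\<integral>\<omega>'. smp_loss lam n ((\<lambda>i. Z i \<omega>)(0 := Z 0 \<omega>')) \<partial>M) \<partial>M)"
    by (simp only: risk_def Z_def smp_loss_upd fst_conv snd_conv)
  also have "\<dots> = (\<integral>z. smp_loss lam n z \<partial>Pi\<^sub>M {..n} (\<lambda>_. P))"
    unfolding P_def
  proof (rule expectation_fresh_test_point[OF \<open>n \<ge> 1\<close> indep])
    show "distr M borel (Z i) = distr M borel (Z 0)" if "i \<le> n" for i
      unfolding Z_def[abs_def] using that by (rule assms(5))
    show "integrable (Pi\<^sub>M {..n} (\<lambda>_. distr M borel (Z 0))) (smp_loss lam n)"
      using loo(1) by (simp add: P_def)
  qed (use \<open>lam > 0\<close> in \<open>auto intro: borel_measurable_smp_loss smp_loss_cong\<close>)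
  finally have excess: "(\<integral>\<omega>. risk M (X 0) (Y 0) (ridge_smp lam n (\<lambda>i. X i \<omega>) (\<lambda>i. Y i \<omega>)) \<partial>M)
    \<le> risk M (X 0) (Y 0) (logistic_model \<theta>) + lam / 2 * (norm \<theta>)\<^sup>2 + exp 1 * df / (real n + 1)" for \<theta>
    using loo(2)[of \<theta>] by (simp add: int_f)
  \<comment> \<open>\<open>excess\<close> holds for every \<theta> with the same last term, so it
    passes to the infimum.\<close>
  have "(\<integral>\<omega>. risk M (X 0) (Y 0) (ridge_smp lam n (\<lambda>i. X i \<omega>) (\<lambda>i. Y i \<omega>)) \<partial>M) - exp 1 * df / (real n + 1)
    \<le> (INF \<theta>. risk M (X 0) (Y 0) (logistic_model \<theta>) + lam / 2 * (norm \<theta>)\<^sup>2)"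
    using excess by (intro cINF_greatest) (auto simp: algebra_simps)
  \<comment> \<open>The argument yields the denominator \<open>n + 1\<close>;
    \<open>df \<ge> 0\<close> allows weakening it to \<open>n\<close>.\<close>
  moreover have "exp 1 * df / (real n + 1) \<le> exp 1 * (df / real n)"
    using \<open>df \<ge> 0\<close> \<open>n \<ge> 1\<close> by (simp add: frac_le)
  ultimately show ?thesis by (simp add: df_def S_def)
qed

end
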